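(* Assume $\mathsf{CH}$. Then there is a maximal $p$-filter $\mathcal{F}$ on $\mathbb{Q}$ which is $\mathbb{Q}$-basically generated.
   Context: $\mathbb{Q}$ is the set of rationals with its usual topology; $Dense(\mathbb{Q})$ is the family of dense subsets of $\mathbb{Q}$. A filter $\mathcal{F}\subseteq Dense(\mathbb{Q})$ on $\mathbb{Q}$ is a maximal filter if for every $X\in Dense(\mathbb{Q})$, either $X\in\mathcal{F}$ or there is $Y\in\mathcal{F}$ such that $X\cap Y\notin Dense(\mathbb{Q})$. A filter $\mathcal{F}$ is a $p$-filter if for every countable $\{X_n:n\in\omega\}\subseteq\mathcal{F}$ there is $X\in\mathcal{F}$ with $X\setminus X_n$ finite for all $n$. A maximal $p$-filter is a maximal filter which is a $p$-filter. A filter $\mathcal{F}$ on $\mathbb{Q}$ is $\mathbb{Q}$-basically generated if it has a base $\mathcal{B}$ such that for every sequence $\langle X_n:n\in\omega\rangle$ of elements of $\mathcal{B}$, every sequence $\langle U_n:n\in\omega\rangle$ of open subsets of $\mathbb{Q}$, every open $V\subseteq\mathbb{Q}$ and every $Y\in\mathcal{B}$ such that $\lim_{n}(X_n\cap U_n)=Y\cap V$, there are $A\in[\omega]^\omega$ and $Z\in\mathcal{B}$ such that $Z\cap V\subseteq\bigcap_{n\in A}X_n\cap V$. Limits of sequences of sets are taken in $2^{\mathbb{Q}}$ (pointwise convergence of characteristic functions). *)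

theory Defs
  imports "HOL-Analysis.Analysis"
begin

definition continuum_hypothesis :: bool where
  "continuum_hypothesis \<longleftrightarrow> (card_of (UNIV :: nat set set), cardSuc natLeq) \<in> ordIso"

(* The library gives type rat no topology; this is the one inherited from the real line. *)
definition rat_topology :: "rat topology" where
  "rat_topology = pullback_topology UNIV real_of_rat euclidean"

definition dense_rat :: "rat set set" where
  "dense_rat = {X. rat_topology closure_of X = UNIV}"

(* The library type of filters represents a filter by its eventually-predicate;
   this is the corresponding family of sets. *)
definition filter_sets :: "'a filter \<Rightarrow> 'a set set" where
  "filter_sets F = {X. eventually (\<lambda>x. x \<in> X) F}"

definition maximal_filter :: "rat filter \<Rightarrow> bool" where
  "maximal_filter F \<longleftrightarrow>
     filter_sets F \<subseteq> dense_rat \<and>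
     (\<forall>X\<in>dense_rat. X \<in> filter_sets F \<or> (\<exists>Y\<in>filter_sets F. X \<inter> Y \<notin> dense_rat))"

definition p_filter :: "'a filter \<Rightarrow> bool" where
  "p_filter F \<longleftrightarrow>
     (\<forall>X :: nat \<Rightarrow> 'a set. range X \<subseteq> filter_sets F \<longrightarrow>
        (\<exists>Y\<in>filter_sets F. \<forall>n. finite (Y - X n)))"

definition maximal_p_filter :: "rat filter \<Rightarrow> bool" where
  "maximal_p_filter F \<longleftrightarrow> maximal_filter F \<and> p_filter F"

definition filter_base :: "'a set set \<Rightarrow> 'a filter \<Rightarrow> bool" where
  "filter_base B F \<longleftrightarrow> B \<subseteq> filter_sets F \<and> (\<forall>X\<in>filter_sets F. \<exists>Y\<in>B. Y \<subseteq> X)"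

definition set_tendsto :: "(nat \<Rightarrow> 'a set) \<Rightarrow> 'a set \<Rightarrow> bool" where
  "set_tendsto S L \<longleftrightarrow> (\<forall>q. (\<lambda>n. indicat_real (S n) q) \<longlonglongrightarrow> indicat_real L q)"

definition rat_basically_generated :: "rat filter \<Rightarrow> bool" where
  "rat_basically_generated F \<longleftrightarrow>
     (\<exists>B. filter_base B F \<and>
       (\<forall>(X :: nat \<Rightarrow> rat set) (U :: nat \<Rightarrow> rat set) V. \<forall>Y\<in>B.
          range X \<subseteq> B \<longrightarrow> (\<forall>n. openin rat_topology (U n)) \<longrightarrow> openin rat_topology V \<longrightarrow>
          set_tendsto (\<lambda>n. X n \<inter> U n) (Y \<inter> V) \<longrightarrow>
          (\<exists>A :: nat set. infinite A \<and> (\<exists>Z\<in>B. Z \<inter> V \<subseteq> (\<Inter>n\<in>A. X n) \<inter> V))))"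

end

(* Under CH the tasks (X, V, Y), with X a sequence of sets, can be well-ordered so that every
   proper initial segment is countable. Along this order one builds an almost decreasing tower of
   dense sets D a: a countable almost decreasing family has a dense almost-intersection, and inside
   it one can treat the task a = (X, V, Y). Either finitely many of the sets Y, X 0, X 1, ... already
   meet it in a non-dense set, so that they can never all belong to the filter, or D a is chosen
   inside Y and almost inside every X n; if moreover every point of Y inter V lies in almost all X n,
   then D a is thinned out while choosing infinitely many n with D a inter V contained in X n.
   The filter generated by the tower modulo finite sets is its own witnessing base, and constant
   sequences give maximality. *)

theory Submission
  imports Defs "HOL-Library.Countable_Set_Type"
begin

section \<open>Dense sets of rationals\<close>

text \<open>Open intervals with rational end points form a base of the topology, so density becomes
  a statement about the order alone.\<close>

lemma dense_rat_iff:
  "X \<in> dense_rat \<longleftrightarrow> (\<forall>a b. a < b \<longrightarrow> (\<exists>x\<in>X. a < x \<and> x < b))"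
proof
  assume X: "X \<in> dense_rat"
  show "\<forall>a b. a < b \<longrightarrow> (\<exists>x\<in>X. a < x \<and> x < b)"
  proof (intro allI impI)
    fix a b :: rat
    assume "a < b"
    define T where "T = real_of_rat -` {of_rat a <..< of_rat b} \<inter> UNIV"
    have "openin rat_topology T"
      unfolding rat_topology_def openin_pullback_topology T_def
      by (metis open_greaterThanLessThan open_openin)
    moreover have "(a + b) / 2 \<in> T"
      using \<open>a < b\<close> by (simp add: T_def of_rat_less)
    moreover have "(a + b) / 2 \<in> rat_topology closure_of X"
      using X by (simp add: dense_rat_def)
    ultimately obtain y where "y \<in> X" "y \<in> T"
      unfolding in_closure_of by blast
    then show "\<exists>x\<in>X. a < x \<and> x < b"
      by (auto simp: T_def of_rat_less)
  qed
next
  assume X: "\<forall>a b. a < b \<longrightarrow> (\<exists>x\<in>X. a < x \<and> x < b)"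
  have "x \<in> rat_topology closure_of X" for x
    unfolding in_closure_of
  proof (intro conjI allI impI)
    show "x \<in> topspace rat_topology"
      by (simp add: rat_topology_def topspace_pullback_topology)
  next
    fix T
    assume T: "x \<in> T \<and> openin rat_topology T"
    then obtain W where W: "open W" "T = real_of_rat -` W"
      by (auto simp: rat_topology_def openin_pullback_topology)
    with T obtain e where e: "e > 0" "ball (real_of_rat x) e \<subseteq> W"
      using open_contains_ball by (metis vimageE)
    \<comment> \<open>A point of \<open>X\<close> slightly to the right of \<open>x\<close>
      suffices, so only the right half of the ball is used.\<close>
    obtain b where b: "real_of_rat x < of_rat b" "of_rat b < real_of_rat x + e"
      using of_rat_dense[of "real_of_rat x" "real_of_rat x + e"] e(1) by auto
    obtain y where y: "y \<in> X" "x < y" "y < b"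
      using X b(1) by (auto simp: of_rat_less)
    have "real_of_rat x < of_rat y" "real_of_rat y < of_rat b"
      using y by (simp_all add: of_rat_less)
    then have "of_rat y \<in> ball (real_of_rat x) e"
      using b by (auto simp: dist_real_def)
    then show "\<exists>y. y \<in> X \<and> y \<in> T"
      using y(1) e(2) W(2) by auto
  qed
  then show "X \<in> dense_rat"
    by (auto simp: dense_rat_def)
qed

lemma dense_rat_mono: "X \<in> dense_rat \<Longrightarrow> X \<subseteq> Y \<Longrightarrow> Y \<in> dense_rat"
  unfolding dense_rat_iff by (meson subsetD)

lemma UNIV_dense_rat: "UNIV \<in> dense_rat"
  unfolding dense_rat_iff by (simp add: dense)

lemma dense_rat_remove:
  assumes "X \<in> dense_rat"
  shows "X - {p} \<in> dense_rat"
  unfolding dense_rat_iff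
proof (intro allI impI)
  fix a b :: rat
  assume "a < b"
  \<comment> \<open>Take \<open>c = p\<close> if \<open>p\<close> lies strictly between
    \<open>a\<close> and \<open>b\<close>, and \<open>c = b\<close> otherwise.\<close>
  then obtain c where "a < c" "c \<le> b" "\<not> (a < p \<and> p < c)"
    by (meson linorder_not_less order_less_irrefl order_less_le_trans order_le_less)
  moreover obtain x where "x \<in> X" "a < x" "x < c"
    using assms \<open>a < c\<close> unfolding dense_rat_iff by blast
  ultimately show "\<exists>x\<in>X - {p}. a < x \<and> x < b"
    by (intro bexI[of _ x]) auto
qed

text \<open>Finitely many points can be removed one at a time, so density may be treated modulo
  finite sets.\<close>

lemma dense_rat_almost_mono:
  assumes "X \<in> dense_rat" "finite (X - Z)"
  shows "Z \<in> dense_rat"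
proof -
  have "X - K \<in> dense_rat" if "finite K" for K
    using that
  proof induction
    case empty
    then show ?case using assms(1) by simp
  next
    case (insert p K)
    show ?case
      by (subst Diff_insert) (rule dense_rat_remove[OF insert.IH])
  qed
  from this[OF assms(2)] show ?thesis
    by (rule dense_rat_mono) blast
qed

section \<open>Diagonal constructions of dense sets\<close>

lemma countable_rat_intervals:
  obtains I :: "nat \<Rightarrow> rat set" where "\<And>X. X \<in> dense_rat \<longleftrightarrow> (\<forall>n. X \<inter> I n \<noteq> {})"
proof
  \<comment> \<open>A pair with \<open>a \<ge> b\<close> is sent to \<open>UNIV\<close>, since no
    set meets an empty interval. Coding pairs by naturals turns density into countably many
    requirements.\<close>
  define J :: "rat \<times> rat \<Rightarrow> rat set"
    where "J = (\<lambda>(a, b). if a < b then {a<..<b} else UNIV)"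
  fix X
  have "X \<in> dense_rat \<longleftrightarrow> (\<forall>p. X \<inter> J p \<noteq> {})"
  proof
    assume X: "X \<in> dense_rat"
    then have "X \<noteq> {}"
      using zero_less_one unfolding dense_rat_iff by blast
    then show "\<forall>p. X \<inter> J p \<noteq> {}"
      using X by (force simp: J_def dense_rat_iff)
  next
    assume X: "\<forall>p. X \<inter> J p \<noteq> {}"
    show "X \<in> dense_rat"
      unfolding dense_rat_iff
    proof (intro allI impI)
      fix a b :: rat
      assume "a < b"
      then show "\<exists>x\<in>X. a < x \<and> x < b"
        using X[rule_format, of "(a, b)"] by (auto simp: J_def)
    qed
  qed
  also have "\<dots> \<longleftrightarrow> (\<forall>p\<in>range from_nat. X \<inter> J p \<noteq> {})"
    by simp
  also have "\<dots> \<longleftrightarrow> (\<forall>n. X \<inter> J (from_nat n) \<noteq> {})"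
    by blast
  finally show "X \<in> dense_rat \<longleftrightarrow> (\<forall>n. X \<inter> J (from_nat n) \<noteq> {})" .
qed

text \<open>Pick \<open>d n\<close> in \<open>I n\<close> and in all of \<open>E 0\<close>, ...,
  \<open>E n\<close>. The range meets every interval, and only the \<open>d i\<close> with
  \<open>i < n\<close> can fall outside \<open>E n\<close>.\<close>

lemma dense_rat_pseudo_intersection:
  fixes E :: "nat \<Rightarrow> rat set"
  assumes "\<And>n. (\<Inter>i\<le>n. E i) \<in> dense_rat"
  obtains D where "D \<in> dense_rat" "D \<subseteq> E 0" "\<And>n. finite (D - E n)"
proof -
  obtain I :: "nat \<Rightarrow> rat set" where I: "\<And>X. X \<in> dense_rat \<longleftrightarrow> (\<forall>n. X \<inter> I n \<noteq> {})"
    using countable_rat_intervals by blast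
  have "\<exists>x. x \<in> (\<Inter>i\<le>n. E i) \<inter> I n" for n
    using assms[of n] I by blast
  then obtain d where d: "\<And>n. d n \<in> (\<Inter>i\<le>n. E i) \<inter> I n"
    by metis
  show ?thesis
  proof
    show "range d \<in> dense_rat"
      using d unfolding I by blast
    show "range d \<subseteq> E 0"
      using d by blast
    have "range d - E n \<subseteq> d ` {..<n}" for n
      using d by (force simp: not_less)
    then show "finite (range d - E n)" for n
      using finite_subset by blast
  qed
qed

text \<open>Points of \<open>D\<close> and indices of \<open>A\<close> are chosen alternately. A new
  point can respect the indices chosen so far because \<open>E\<close> is almost contained in each
  \<open>X n\<close>; a new index can respect the points chosen so far by \<open>ev\<close>.\<close>

lemma dense_rat_thinning:
  fixes X :: "nat \<Rightarrow> rat set"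
  assumes E: "E \<in> dense_rat" "\<And>n. finite (E - X n)"
    and ev: "\<And>q. q \<in> E \<inter> V \<Longrightarrow> \<forall>\<^sub>F n in sequentially. q \<in> X n"
  obtains D A where "D \<in> dense_rat" "D \<subseteq> E" "infinite A" "\<And>n. n \<in> A \<Longrightarrow> D \<inter> V \<subseteq> X n"
proof -
  obtain I :: "nat \<Rightarrow> rat set" where I: "\<And>X. X \<in> dense_rat \<longleftrightarrow> (\<forall>n. X \<inter> I n \<noteq> {})"
    using countable_rat_intervals by blast
  \<comment> \<open>Finite approximations, \<open>S\<close> to \<open>D\<close> and \<open>N\<close>
    to \<open>A\<close>. In \<open>Q\<close>, stage \<open>k\<close> makes \<open>S'\<close> meet
    \<open>I k\<close> and gives \<open>N'\<close> an index at least \<open>k\<close>, so that the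
    union of the index sets is infinite.\<close>
  define P where "P = (\<lambda>(S, N). finite S \<and> finite N \<and> S \<subseteq> E \<and> (\<forall>n\<in>N. S \<inter> V \<subseteq> X n))"
  define Q where "Q = (\<lambda>k (S, N) (S', N'). S \<subseteq> S' \<and> N \<subseteq> N' \<and> S' \<inter> I k \<noteq> {}
    \<and> (\<exists>n\<in>N'. k \<le> (n::nat)))"
  have step: "\<exists>y. P y \<and> Q k x y" if "P x" for x k
  proof -
    obtain S N where x: "x = (S, N)" by fastforce
    have SN: "finite S" "finite N" "S \<subseteq> E" "\<forall>n\<in>N. S \<inter> V \<subseteq> X n"
      using that by (auto simp: P_def x)
    have "finite (E - (\<Inter>n\<in>N. X n) \<inter> E)"
    proof (rule finite_subset)
      show "E - (\<Inter>n\<in>N. X n) \<inter> E \<subseteq> (\<Union>n\<in>N. E - X n)" by blast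
      show "finite (\<Union>n\<in>N. E - X n)" using SN(2) E(2) by (rule finite_UN_I)
    qed
    then have "(\<Inter>n\<in>N. X n) \<inter> E \<in> dense_rat"
      using E(1) dense_rat_almost_mono by blast
    then obtain d where d: "d \<in> (\<Inter>n\<in>N. X n) \<inter> E \<inter> I k"
      unfolding I by blast
    have "finite (insert d S \<inter> V)"
      using SN by simp
    then have "\<forall>\<^sub>F n in sequentially. \<forall>q\<in>insert d S \<inter> V. q \<in> X n"
      using ev d SN(3) by (subst eventually_ball_finite_distrib) auto
    then obtain n where n: "n \<ge> k" "insert d S \<inter> V \<subseteq> X n"
      unfolding eventually_sequentially by (metis nle_le subsetI)
    have "P (insert d S, insert n N)" "Q k x (insert d S, insert n N)"
      using SN d n by (auto simp: P_def Q_def x)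
    then show ?thesis by blast
  qed
  moreover have "\<exists>x. P x"
    by (rule exI[of _ "({}, {})"]) (simp add: P_def)
  ultimately obtain f where f: "\<And>k. P (f k)" "\<And>k. Q k (f k) (f (Suc k))"
    using dependent_nat_choice[of "\<lambda>_. P" Q] by blast
  define S where "S k = fst (f k)" for k
  define N where "N k = snd (f k)" for k
  have SN: "S k \<subseteq> E" "\<forall>n\<in>N k. S k \<inter> V \<subseteq> X n" "S k \<subseteq> S (Suc k)" "N k \<subseteq> N (Suc k)"
    "S (Suc k) \<inter> I k \<noteq> {}" "\<exists>n\<in>N (Suc k). k \<le> n" for k
    using f(1)[of k] f(2)[of k] by (auto simp: P_def Q_def S_def N_def split: prod.splits)
  have mono: "mono S" "mono N"
    using SN by (auto simp: mono_iff_le_Suc)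
  show ?thesis
  proof
    show "(\<Union>k. S k) \<in> dense_rat"
      using SN(5) unfolding I by blast
    show "(\<Union>k. S k) \<subseteq> E"
      using SN(1) by blast
    show "infinite (\<Union>k. N k)"
      unfolding infinite_nat_iff_unbounded_le using SN(6) by blast
    show "(\<Union>k. S k) \<inter> V \<subseteq> X n" if n: "n \<in> (\<Union>k. N k)" for n
    proof
      fix q
      assume "q \<in> (\<Union>k. S k) \<inter> V"
      then obtain i j where "q \<in> S i" "n \<in> N j" "q \<in> V"
        using n by blast
      \<comment> \<open>At a common later stage the invariant \<open>P\<close> covers the point and
        the index together.\<close>
      then have "q \<in> S (max i j)" "n \<in> N (max i j)"
        using monoD[OF mono(1), of i "max i j"] monoD[OF mono(2), of j "max i j"] by auto
      then show "q \<in> X n"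
        using SN(2) \<open>q \<in> V\<close> by blast
    qed
  qed
qed

section \<open>The tower\<close>

text \<open>Convergence of \<open>X n \<inter> U n\<close> to \<open>Y \<inter> V\<close> enters
  through its consequence that each point of \<open>Y \<inter> V\<close> lies in almost all
  \<open>X n\<close>; a task can thus be recorded by \<open>X\<close>, \<open>V\<close> and
  \<open>Y\<close>.\<close>

definition settles :: "rat set \<Rightarrow> (nat \<Rightarrow> rat set) \<Rightarrow> rat set \<Rightarrow> rat set \<Rightarrow> bool" where
  "settles D X V Y \<longleftrightarrow>
     (\<exists>n. D \<inter> Y \<inter> (\<Inter>i\<le>n. X i) \<notin> dense_rat) \<or>
     D \<subseteq> Y \<and> (\<forall>n. finite (D - X n)) \<and>
     ((\<forall>q\<in>Y \<inter> V. \<forall>\<^sub>F n in sequentially. q \<in> X n) \<longrightarrow>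
        (\<exists>A. infinite A \<and> (\<forall>n\<in>A. D \<inter> V \<subseteq> X n)))"

lemma settles_exists:
  assumes "D \<in> dense_rat"
  obtains D' where "D' \<in> dense_rat" "D' \<subseteq> D" "settles D' X V Y"
proof (cases "\<exists>n. D \<inter> Y \<inter> (\<Inter>i\<le>n. X i) \<notin> dense_rat")
  case True
  then show ?thesis
    using that[of D] assms by (auto simp: settles_def)
next
  case False
  \<comment> \<open>With \<open>D\<close> and \<open>Y\<close> in every term, the exact inclusion in
    \<open>G 0\<close> places \<open>E\<close> inside both, not just almost inside.\<close>
  define G where "G i = D \<inter> Y \<inter> X i" for i
  have "(\<Inter>i\<le>n. G i) = D \<inter> Y \<inter> (\<Inter>i\<le>n. X i)" for n
    by (auto simp: G_def)
  with False obtain E where E: "E \<in> dense_rat" "E \<subseteq> G 0" "\<And>n. finite (E - G n)"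
    using dense_rat_pseudo_intersection[of G] by metis
  have sub: "E \<subseteq> D" "E \<subseteq> Y"
    using E(2) by (auto simp: G_def)
  have fin: "finite (E - X n)" for n
    using finite_subset[OF _ E(3)[of n], of "E - X n"] by (auto simp: G_def)
  show ?thesis
  proof (cases "\<forall>q\<in>Y \<inter> V. \<forall>\<^sub>F n in sequentially. q \<in> X n")
    case True
    then have "\<forall>\<^sub>F n in sequentially. q \<in> X n" if "q \<in> E \<inter> V" for q
      using that sub by blast
    then obtain D' A where D': "D' \<in> dense_rat" "D' \<subseteq> E" "infinite A" "\<And>n. n \<in> A \<Longrightarrow> D' \<inter> V \<subseteq> X n"
      using dense_rat_thinning[OF E(1), of X V] fin by blast
    have "finite (D' - X n)" for n
      using finite_subset[OF _ fin[of n], of "D' - X n"] D'(2) by blast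
    then have "settles D' X V Y"
      using D' sub unfolding settles_def by blast
    then show ?thesis
      using that D' sub by blast
  next
    case False
    then have "settles E X V Y"
      using sub fin unfolding settles_def by blast
    then show ?thesis
      using that E sub by blast
  qed
qed

section \<open>Well-ordering and coding the tasks under CH\<close>

lemma continuum_hypothesis_well_order:
  assumes "continuum_hypothesis"
  obtains r :: "nat set rel"
  where "wf r" "trans r" "total r" "\<And>a. countable {b. (b, a) \<in> r}"
proof
  let ?c = "card_of (UNIV :: nat set set)"
  have "Well_order ?c" and co: "Card_order ?c" and fld: "Field ?c = UNIV"
    using card_of_Well_order card_of_Card_order by (auto simp: Field_card_of)
  then have lin: "Linear_order ?c" and "wf (?c - Id)"
    by (auto simp: well_order_on_def)
  then show "wf (?c - Id)" by simp
  show "trans (?c - Id)"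
    using lin by (auto simp: order_on_defs intro: trans_diff_Id)
  show "total (?c - Id)"
    using lin fld by (auto simp: order_on_defs)
  show "countable {b. (b, a) \<in> ?c - Id}" for a
  proof -
    \<comment> \<open>Initial segments of a cardinal order have smaller cardinality; under CH this
      is below the successor of aleph-zero, hence at most aleph-zero.\<close>
    have "(card_of (underS ?c a), ?c) \<in> ordLess"
      using card_of_underS[OF co] fld by simp
    then have "(card_of (underS ?c a), cardSuc natLeq) \<in> ordLess"
      using assms ordLess_ordIso_trans unfolding continuum_hypothesis_def by blast
    then have "(card_of (underS ?c a), natLeq) \<in> ordLeq"
      using cardSuc_ordLeq_ordLess[OF natLeq_Card_order card_of_Card_order] by blast
    then have "countable (underS ?c a)"
      by (simp only: countable_card_le_natLeq)
    then show ?thesis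
      by (rule countable_subset[rotated]) (auto simp: underS_def)
  qed
qed

lemma surj_tasks:
  obtains t :: "nat set \<Rightarrow> (nat \<Rightarrow> 'a::countable set) \<times> 'a set \<times> 'a set"
  where "surj t"
proof
  \<comment> \<open>A set of naturals is read as a sequence of slices: slice 0 codes
    \<open>V\<close>, slice 1 codes \<open>Y\<close>, slice \<open>n + 2\<close> codes
    \<open>X n\<close>.\<close>
  define g :: "nat set \<Rightarrow> nat \<Rightarrow> 'a set" where "g S n = {q. to_nat (n, q) \<in> S}" for S n
  define t where "t S = (\<lambda>n. g S (n + 2), g S 0, g S 1)" for S
  show "surj t"
    unfolding surj_def
  proof
    fix y :: "(nat \<Rightarrow> 'a set) \<times> 'a set \<times> 'a set"
    obtain X V Y where y: "y = (X, V, Y)" by (metis prod_cases3)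
    define S where "S = to_nat ` {(n, q). q \<in> case_nat V (case_nat Y X) n}"
    have "g S n = case_nat V (case_nat Y X) n" for n
      by (auto simp: g_def S_def inj_image_mem_iff)
    then have "t S = y"
      by (simp add: t_def y)
    then show "\<exists>x. y = t x" by blast
  qed
qed

text \<open>Serves to find the latest of finitely many tower indices, whose set is almost contained
  in the sets at the others.\<close>

lemma finite_subset_maximum:
  assumes "finite S" "S \<noteq> {}" "trans r" "total r"
  obtains m where "m \<in> S" "\<And>b. b \<in> S \<Longrightarrow> b = m \<or> (b, m) \<in> r"
proof -
  have "\<exists>m\<in>S. \<forall>b\<in>S. b = m \<or> (b, m) \<in> r"
    using assms(1,2)
  proof (induction rule: finite_ne_induct)
    case (singleton x)
    then show ?case by simp
  next
    case (insert x S)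
    then obtain m where m: "m \<in> S" "\<forall>b\<in>S. b = m \<or> (b, m) \<in> r" by blast
    consider "x = m" | "(x, m) \<in> r" | "(m, x) \<in> r"
      using assms(4) by (auto simp: total_on_def)
    then show ?case
    proof cases
      case 3
      then have "\<forall>b\<in>S. (b, x) \<in> r"
        using m assms(3) by (metis transD)
      then show ?thesis by blast
    qed (use m in auto)
  qed
  then show thesis using that by blast
qed

text \<open>Well-founded recursion on \<open>r\<close>. Any finite intersection of earlier sets
  almost contains the one of latest index, so it is dense; as the earlier sets are countably many,
  they have a dense almost-intersection, inside which the task is settled.\<close>

lemma tower_exists:
  fixes t :: "'i \<Rightarrow> (nat \<Rightarrow> rat set) \<times> rat set \<times> rat set"
  assumes r: "wf r" "trans r" "total r" "\<And>a. countable {b. (b, a) \<in> r}"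
  obtains D where "\<And>a. D a \<in> dense_rat" "\<And>a b. (b, a) \<in> r \<Longrightarrow> finite (D a - D b)"
    "\<And>a X V Y. t a = (X, V, Y) \<Longrightarrow> settles (D a) X V Y"
proof -
  define P where "P D a d \<longleftrightarrow> d \<in> dense_rat \<and> (\<forall>b. (b, a) \<in> r \<longrightarrow> finite (d - D b))
    \<and> (case t a of (X, V, Y) \<Rightarrow> settles d X V Y)" for D :: "'i \<Rightarrow> rat set" and a d
  have "\<exists>D. \<forall>a. P D a (D a)"
  proof (rule dependent_wf_choice[OF r(1)])
    \<comment> \<open>The demand at \<open>x\<close> sees only earlier values of the tower, as the
      recursion requires.\<close>
    show "P f x d = P g x d" if "\<And>z. (z, x) \<in> r \<Longrightarrow> f z = g z" for f g x d
      using that by (auto simp: P_def)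
  next
    fix a D
    assume IH: "\<And>b. (b, a) \<in> r \<Longrightarrow> P D b (D b)"
    \<comment> \<open>\<open>UNIV\<close> keeps \<open>C\<close> nonempty even at the least index,
      so that the naturals can enumerate it.\<close>
    define C where "C = insert UNIV (D ` {b. (b, a) \<in> r})"
    define E where "E = from_nat_into C"
    have "countable C" "C \<noteq> {}"
      using r(4) by (auto simp: C_def)
    then have E: "range E = C"
      unfolding E_def by (rule range_from_nat_into[rotated])
    have "(\<Inter>i\<le>n. E i) \<in> dense_rat" for n
    proof -
      \<comment> \<open>Dropping \<open>UNIV\<close> leaves the intersection unchanged and leaves
        only tower sets.\<close>
      have "finite (E ` {..n} - {UNIV})" "E ` {..n} - {UNIV} \<subseteq> D ` {b. (b, a) \<in> r}"
        using E by (auto simp: C_def)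
      then obtain S where S: "finite S" "S \<subseteq> {b. (b, a) \<in> r}" "E ` {..n} - {UNIV} = D ` S"
        by (metis finite_subset_image)
      have eq: "(\<Inter>i\<le>n. E i) = (\<Inter>b\<in>S. D b)"
        unfolding S(3)[symmetric] by blast
      show ?thesis
      proof (cases "S = {}")
        case True
        then show ?thesis using eq UNIV_dense_rat by simp
      next
        case False
        then obtain m where m: "m \<in> S" "\<And>b. b \<in> S \<Longrightarrow> b = m \<or> (b, m) \<in> r"
          using finite_subset_maximum[OF S(1) _ r(2,3)] by blast
        then have Pm: "P D m (D m)" using IH S(2) by blast
        have "finite (D m - D b)" if "b \<in> S" for b
          using m(2)[OF that] Pm by (auto simp: P_def)
        then have "finite (\<Union>b\<in>S. D m - D b)"
          using S(1) by blast
        moreover have "(\<Union>b\<in>S. D m - D b) = D m - (\<Inter>b\<in>S. D b)"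
          by blast
        ultimately show ?thesis
          using Pm dense_rat_almost_mono unfolding eq P_def by metis
      qed
    qed
    then obtain D0 where D0: "D0 \<in> dense_rat" "\<And>n. finite (D0 - E n)"
      using dense_rat_pseudo_intersection by metis
    obtain X V Y where t: "t a = (X, V, Y)" by (metis prod_cases3)
    obtain d where d: "d \<in> dense_rat" "d \<subseteq> D0" "settles d X V Y"
      using settles_exists[OF D0(1)] by blast
    have "finite (d - D b)" if "(b, a) \<in> r" for b
    proof -
      have "D b \<in> range E" using that E by (auto simp: C_def)
      then have "finite (D0 - D b)" using D0(2) by auto
      then show ?thesis by (rule finite_subset[rotated]) (use d in blast)
    qed
    then show "\<exists>d. P D a d"
      using d t by (auto simp: P_def)
  qed
  then obtain D where D: "\<And>a. P D a (D a)" by blast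
  show ?thesis
  proof
    show "D a \<in> dense_rat" for a
      using D by (simp add: P_def)
    show "finite (D a - D b)" if "(b, a) \<in> r" for a b
      using D that by (simp add: P_def)
    show "settles (D a) X V Y" if "t a = (X, V, Y)" for a X V Y
      using D[of a] that by (simp add: P_def)
  qed
qed

section \<open>The filter generated by the tower\<close>

text \<open>For closure under intersection: of two tower sets, the one with the later index is
  almost contained in the other and so serves for both.\<close>

lemma tower_filter:
  fixes D :: "'i \<Rightarrow> 'a set"
  assumes r: "total r" and D: "\<And>a b. (b, a) \<in> r \<Longrightarrow> finite (D a - D b)"
  obtains F where "filter_sets F = {X. \<exists>a. finite (D a - X)}"
proof -
  define ev where "ev P \<longleftrightarrow> (\<exists>a. finite (D a - Collect P))" for P
  have "is_filter ev"
  proof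
    show "ev (\<lambda>_. True)" by (simp add: ev_def)
  next
    fix P Q
    assume "ev P" "ev Q"
    then obtain a b where ab: "finite (D a - Collect P)" "finite (D b - Collect Q)"
      by (auto simp: ev_def)
    have "\<exists>c. finite (D c - D a) \<and> finite (D c - D b)"
    proof (cases "a = b")
      case True
      then show ?thesis by (intro exI[of _ a]) simp
    next
      case False
      then show ?thesis using r D unfolding total_on_def
        by (metis Diff_cancel UNIV_I finite.emptyI)
    qed
    then obtain c where c: "finite (D c - D a)" "finite (D c - D b)" by blast
    have "D c - Collect (\<lambda>x. P x \<and> Q x)
        \<subseteq> (D c - D a) \<union> (D c - D b) \<union> (D a - Collect P) \<union> (D b - Collect Q)"
      by blast
    then have "finite (D c - Collect (\<lambda>x. P x \<and> Q x))"
      by (rule finite_subset) (use ab c in blast)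
    then show "ev (\<lambda>x. P x \<and> Q x)" unfolding ev_def by blast
  next
    fix P Q
    assume PQ: "\<forall>x. P x \<longrightarrow> Q x" and "ev P"
    then obtain a where "finite (D a - Collect P)" by (auto simp: ev_def)
    then have "finite (D a - Collect Q)"
      by (rule finite_subset[rotated]) (use PQ in blast)
    then show "ev Q" unfolding ev_def by blast
  qed
  then have "filter_sets (Abs_filter ev) = {X. \<exists>a. finite (D a - X)}"
    by (simp add: filter_sets_def eventually_Abs_filter) (simp add: ev_def)
  then show thesis by (fact that)
qed

lemma filter_sets_Int: "X \<in> filter_sets F \<Longrightarrow> Y \<in> filter_sets F \<Longrightarrow> X \<inter> Y \<in> filter_sets F"
  by (simp add: filter_sets_def eventually_conj)

lemma filter_sets_finite_INT:
  "finite I \<Longrightarrow> (\<And>i. i \<in> I \<Longrightarrow> X i \<in> filter_sets F) \<Longrightarrow> (\<Inter>i\<in>I. X i) \<in> filter_sets F"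
  by (simp add: filter_sets_def eventually_ball_finite)

lemma set_tendsto_eventually_mem:
  assumes "set_tendsto S L" "q \<in> L"
  shows "\<forall>\<^sub>F n in sequentially. q \<in> S n"
proof -
  have "(\<lambda>n. indicat_real (S n) q) \<longlonglongrightarrow> 1"
    using assms by (auto simp: set_tendsto_def dest: spec[of _ q])
  then have "\<forall>\<^sub>F n in sequentially. indicat_real (S n) q > 0"
    by (rule order_tendstoD) simp
  then show ?thesis
    by (rule eventually_mono) (auto simp: indicator_def split: if_splits)
qed

theorem proposition2p31:
  assumes "continuum_hypothesis"
  shows "\<exists>F :: rat filter. maximal_p_filter F \<and> rat_basically_generated F"
proof -
  obtain r :: "nat set rel" where r: "wf r" "trans r" "total r" "\<And>a. countable {b. (b, a) \<in> r}"
    using continuum_hypothesis_well_order[OF assms] by blast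
  obtain t :: "nat set \<Rightarrow> (nat \<Rightarrow> rat set) \<times> rat set \<times> rat set" where t: "surj t"
    by (fact surj_tasks)
  obtain D where D: "\<And>a. D a \<in> dense_rat" "\<And>a b. (b, a) \<in> r \<Longrightarrow> finite (D a - D b)"
    "\<And>a X V Y. t a = (X, V, Y) \<Longrightarrow> settles (D a) X V Y"
    using tower_exists[OF r, of t] by blast
  obtain F where F: "filter_sets F = {X. \<exists>a. finite (D a - X)}"
    using tower_filter[of r D] r(3) D(2) by blast
  have D_mem: "D a \<in> filter_sets F" for a
    by (auto simp: F intro: exI[of _ a])
  have UNIV_mem: "UNIV \<in> filter_sets F"
    by (simp add: F)
  \<comment> \<open>Members almost contain some dense \<open>D a\<close>. In particular the empty
    set is not a member, so \<open>F\<close> is proper.\<close>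
  have dense: "filter_sets F \<subseteq> dense_rat"
    using D(1) dense_rat_almost_mono by (auto simp: F)
  have settles: "\<exists>a. settles (D a) X V Y" for X V Y
    using t D(3) unfolding surj_def by metis
  \<comment> \<open>The first alternative of \<open>settles\<close> cannot occur for members of
    \<open>F\<close>, because their finite intersections are again members and hence dense.\<close>
  have settled: "\<exists>a. D a \<subseteq> Y \<and> (\<forall>n. finite (D a - X n)) \<and>
      ((\<forall>q\<in>Y \<inter> V. \<forall>\<^sub>F n in sequentially. q \<in> X n) \<longrightarrow>
        (\<exists>A. infinite A \<and> (\<forall>n\<in>A. D a \<inter> V \<subseteq> X n)))"
    if X: "range X \<subseteq> filter_sets F" and Y: "Y \<in> filter_sets F" for X V Y
  proof -
    obtain a where a: "settles (D a) X V Y"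
      using settles by blast
    have "D a \<inter> Y \<inter> (\<Inter>i\<le>n. X i) \<in> dense_rat" for n
      using dense D_mem Y X by (intro subsetD[OF dense] filter_sets_Int filter_sets_finite_INT) auto
    with a show ?thesis
      unfolding settles_def by blast
  qed
  have "maximal_filter F"
    unfolding maximal_filter_def
  proof (intro conjI ballI dense)
    fix X
    \<comment> \<open>For this constant task, \<open>settles\<close> says that either
      \<open>D a \<inter> X\<close> is not dense or \<open>D a\<close> is almost contained in
      \<open>X\<close>.\<close>
    obtain a where a: "settles (D a) (\<lambda>_. X) UNIV UNIV"
      using settles by blast
    show "X \<in> filter_sets F \<or> (\<exists>Y\<in>filter_sets F. X \<inter> Y \<notin> dense_rat)"
    proof (cases "D a \<inter> X \<in> dense_rat")
      case True
      then have "finite (D a - X)"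
        using a by (auto simp: settles_def)
      then show ?thesis by (auto simp: F)
    next
      case False
      then show ?thesis using D_mem[of a] by (auto simp: Int_commute)
    qed
  qed
  moreover have "p_filter F"
    unfolding p_filter_def
  proof (intro allI impI)
    fix X :: "nat \<Rightarrow> rat set"
    assume "range X \<subseteq> filter_sets F"
    then obtain a where "\<forall>n. finite (D a - X n)"
      using settled[OF _ UNIV_mem, of X UNIV] by blast
    then show "\<exists>Y\<in>filter_sets F. \<forall>n. finite (Y - X n)"
      using D_mem by blast
  qed
  moreover have "rat_basically_generated F"
    unfolding rat_basically_generated_def
  \<comment> \<open>The whole filter serves as the base, so any tower set is available as the
    witness \<open>Z\<close>.\<close>
  proof (intro exI[of _ "filter_sets F"] conjI allI ballI impI)
    show "filter_base (filter_sets F) F"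
      by (auto simp: filter_base_def)
  next
    fix X U :: "nat \<Rightarrow> rat set" and V Y
    assume Y: "Y \<in> filter_sets F" and X: "range X \<subseteq> filter_sets F"
      and lim: "set_tendsto (\<lambda>n. X n \<inter> U n) (Y \<inter> V)"
    \<comment> \<open>Membership in \<open>X n \<inter> U n\<close> is weakened to membership in
      \<open>X n\<close>, the form in which tasks are settled.\<close>
    have "\<forall>q\<in>Y \<inter> V. \<forall>\<^sub>F n in sequentially. q \<in> X n"
      using set_tendsto_eventually_mem[OF lim] by (blast intro: eventually_mono)
    with settled[OF X Y, of V] obtain a A where "infinite A" "\<forall>n\<in>A. D a \<inter> V \<subseteq> X n"
      by (elim exE conjE) (drule (1) mp, blast)
    then show "\<exists>A::nat set. infinite A \<and> (\<exists>Z\<in>filter_sets F. Z \<inter> V \<subseteq> (\<Inter>n\<in>A. X n) \<inter> V)"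
      using D_mem[of a] by blast
  qed
  ultimately show ?thesis
    unfolding maximal_p_filter_def by blast
qed

end
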